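(* Let $H$ be a monoid. a) For every $n\geq 1$ and $r_1,\dots,r_n,t_1,\dots,t_n\in\mathcal{R}(H)$ such that $r_i\mid r_{i+1}$ and $t_i\mid t_{i+1}$ for $i=1,\dots,n-1$, if $$r_1r_2\cdots r_n\sim t_1t_2\cdots t_n,$$ then $r_i\sim t_i$ for $i=1,\dots,n$. b) For every $a,c\in H$ and $b,d\in\mathcal{R}(H)$ such that $a\mid b^m$ and $c\mid d^n$ for some $m,n\geq 1$, if $ab\sim cd$, then $a\sim c$ and $b\sim d$.
   Context: Monoid means commutative cancellative monoid (written multiplicatively). An element $a\in H$ is radical if for all $b\in H$ and $n\geq 1$, $a\mid b^n$ implies $a\mid b$; $\mathcal{R}(H)$ is the set of radical elements of $H$. $a\sim b$ means that $a$ and $b$ are associated, i.e. $a=ub$ for some invertible $u\in H$. *)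

theory Defs
  imports "HOL-Algebra.Divisibility" "HOL-Algebra.FiniteProduct"
begin

text \<open>
  Commutative cancellative monoids are modelled by the locale \<^locale>\<open>comm_monoid_cancel\<close>.
  The library relation \<^const>\<open>associated\<close> is mutual divisibility; in a cancellative monoid it
  coincides with equality up to a unit factor, see \<open>associated_iff_unit_multiple\<close> below.
\<close>

definition radicals :: "('a, 'b) monoid_scheme \<Rightarrow> 'a set" where
  "radicals H = {a \<in> carrier H. \<forall>b \<in> carrier H. \<forall>n::nat. n \<ge> 1 \<longrightarrow>
     a divides\<^bsub>H\<^esub> b [^]\<^bsub>H\<^esub> n \<longrightarrow> a divides\<^bsub>H\<^esub> b}"

lemma (in comm_monoid_cancel) associated_iff_unit_multiple:
  assumes "a \<in> carrier G" "b \<in> carrier G"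
  shows "a \<sim> b \<longleftrightarrow> (\<exists>u\<in>Units G. a = u \<otimes> b)"
  using assms m_comm Units_closed by (metis associated_iff)

end

theory Submission
  imports Defs
begin

text \<open>
  If \<open>a\<close> divides a power of \<open>b\<close> and \<open>c\<close> a power of \<open>d\<close>, then \<open>b\<close> divides \<open>a b\<close>, hence \<open>c d\<close>, hence a
  power of \<open>d\<close>; radicality gives that \<open>b\<close> divides \<open>d\<close>, and symmetrically. Cancelling the associated
  factors \<open>b\<close> and \<open>d\<close> yields b). Part a) follows by induction on the length, splitting off the last
  factor with b): all earlier factors divide the last one, so their product divides a power of it.
\<close>

lemma radicals_closed: "a \<in> radicals H \<Longrightarrow> a \<in> carrier H"
  by (simp add: radicals_def)

lemma radicals_dividesD:
  assumes "a \<in> radicals H" "b \<in> carrier H" "a divides\<^bsub>H\<^esub> b [^]\<^bsub>H\<^esub> (n::nat)" "n \<ge> 1"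
  shows "a divides\<^bsub>H\<^esub> b"
  using assms by (auto simp: radicals_def)

context comm_monoid
begin

lemma divides_mult_mono:
  assumes "a divides b" "c divides d"
    and "a \<in> carrier G" "b \<in> carrier G" "c \<in> carrier G" "d \<in> carrier G"
  shows "a \<otimes> c divides b \<otimes> d"
proof -
  have "a \<otimes> c divides a \<otimes> d" "a \<otimes> d divides b \<otimes> d"
    using assms by (auto intro: divides_mult_lI divides_mult_rI)
  then show ?thesis
    using assms by (meson divides_trans m_closed)
qed

lemma finprod_1_Suc:
  assumes "\<And>i. i \<in> {1..Suc n} \<Longrightarrow> f i \<in> carrier G"
  shows "(\<Otimes>i\<in>{1..Suc n}. f i) = (\<Otimes>i\<in>{1..n}. f i) \<otimes> f (Suc n)"
proof -
  have "{1..Suc n} = insert (Suc n) {1..n}"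
    by auto
  then have "finprod G f {1..Suc n} = f (Suc n) \<otimes> finprod G f {1..n}"
    using assms by (simp add: Pi_def)
  then show ?thesis
    using assms by (simp add: Pi_def m_comm)
qed

text \<open>Factors are multiplied one at a time, each contributing one \<open>s\<close>. The chain
  argument uses this with \<open>s\<close> the last member of a chain; for \<open>n = 0\<close> both
  sides are the unit element.\<close>

lemma finprod_divides_pow:
  assumes "\<And>i. i \<in> {1..n} \<Longrightarrow> r i \<in> carrier G \<and> r i divides s" "s \<in> carrier G"
  shows "(\<Otimes>i\<in>{1..n}. r i) divides s [^] (n::nat)"
  using assms
proof (induction n)
  case (Suc n)
  have "finprod G r {1..n} \<otimes> r (Suc n) divides s [^] n \<otimes> s"
    using Suc by (intro divides_mult_mono finprod_closed) auto
  then show ?case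
    using Suc.prems finprod_1_Suc[of n r] by simp
qed simp

text \<open>One direction of b): \<open>b\<close> divides \<open>a \<otimes> b\<close>, hence
  \<open>c \<otimes> d\<close>, hence \<open>d [^] Suc n\<close>. That exponent is positive even for
  \<open>n = 0\<close>, so radicality of \<open>b\<close> applies.\<close>

lemma radicals_mult_divides:
  assumes "a \<in> carrier G" "b \<in> radicals G" "c \<in> carrier G" "d \<in> carrier G"
    and "c divides d [^] (n::nat)" "a \<otimes> b divides c \<otimes> d"
  shows "b divides d"
proof -
  have b: "b \<in> carrier G"
    using assms(2) by (rule radicals_closed)
  have "b divides a \<otimes> b"
    using assms b by (simp add: divides_prod_l)
  moreover have "c \<otimes> d divides d [^] Suc n"
    using assms by (simp add: divides_mult_rI)
  ultimately have "b divides d [^] Suc n"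
    using assms b by (meson divides_trans m_closed)
  then show ?thesis
    using assms by (intro radicals_dividesD[of b G d "Suc n"]) auto
qed

end

context comm_monoid_cancel
begin

text \<open>Zero exponents are allowed here because splitting a chain of length one leaves an empty
  product, which divides the zeroth power.\<close>

lemma radicals_mult_associatedD:
  assumes "a \<in> carrier G" "b \<in> radicals G" "c \<in> carrier G" "d \<in> radicals G"
    and "a divides b [^] (m::nat)" "c divides d [^] (n::nat)" "a \<otimes> b \<sim> c \<otimes> d"
  shows "a \<sim> c" "b \<sim> d"
proof -
  have bd: "b \<in> carrier G" "d \<in> carrier G"
    using assms by (auto intro: radicals_closed)
  \<comment> \<open>Association is mutual divisibility, so the one-sided lemma is used twice, with
    the two pairs exchanged.\<close>
  show "b \<sim> d"
    using assms bd by (auto simp: associated_def intro: radicals_mult_divides)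
  \<comment> \<open>Trading \<open>d\<close> for its associate \<open>b\<close> puts the same factor
    on both sides, where it can be cancelled.\<close>
  have "c \<otimes> d \<sim> c \<otimes> b"
    using \<open>b \<sim> d\<close> assms bd by (simp add: mult_cong_r associated_sym)
  then have "b \<otimes> a \<sim> b \<otimes> c"
    using assms bd by (metis associated_trans m_closed m_comm)
  then show "a \<sim> c"
    using assms bd by (meson assoc_l_cancel)
qed

lemma radicals_chain_unique:
  assumes "\<And>i. i \<in> {1..n} \<Longrightarrow> r i \<in> radicals G \<and> t i \<in> radicals G"
    and "\<And>i. i \<in> {1..<n} \<Longrightarrow> r i divides r (Suc i) \<and> t i divides t (Suc i)"
    and "(\<Otimes>i\<in>{1..n}. r i) \<sim> (\<Otimes>i\<in>{1..n}. t i)"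
    and "i \<in> {1..n::nat}"
  shows "r i \<sim> t i"
  using assms
proof (induction n)
  case (Suc n)
  \<comment> \<open>Stated for a generic \<open>f\<close> so that it serves both \<open>r\<close>
    and \<open>t\<close>. The induction descends from \<open>n\<close>, where the claim is the last
    link of the chain; each step down prepends one more link.\<close>
  have div_last: "f i divides f (Suc n)"
    if "\<And>i. i \<in> {1..Suc n} \<Longrightarrow> f i \<in> carrier G" "\<And>i. i \<in> {1..<Suc n} \<Longrightarrow> f i divides f (Suc i)"
      "i \<in> {1..n}" for f i
  proof -
    have "i \<le> n" "1 \<le> i" using that by auto
    then show ?thesis
    proof (induction i rule: inc_induct)
      case base
      then show ?case using that by auto
    next
      case (step k)
      have "f k divides f (Suc k)" "f (Suc k) divides f (Suc n)" "f k \<in> carrier G"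
        using step that by auto
      then show ?case by (rule divides_trans)
    qed
  qed
  have closed: "r i \<in> carrier G \<and> t i \<in> carrier G" if "i \<in> {1..Suc n}" for i
    using Suc.prems(1)[OF that] by (auto intro: radicals_closed)
  have "finprod G r {1..n} \<otimes> r (Suc n) \<sim> finprod G t {1..n} \<otimes> t (Suc n)"
    using Suc.prems(3) closed finprod_1_Suc[of n r] finprod_1_Suc[of n t] by simp
  moreover have "finprod G r {1..n} divides r (Suc n) [^] n"
    using closed Suc.prems(2) by (intro finprod_divides_pow) (auto intro: div_last)
  moreover have "finprod G t {1..n} divides t (Suc n) [^] n"
    using closed Suc.prems(2) by (intro finprod_divides_pow) (auto intro: div_last)
  moreover have "finprod G r {1..n} \<in> carrier G" "finprod G t {1..n} \<in> carrier G"
    using closed by (auto intro!: finprod_closed)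
  ultimately have "finprod G r {1..n} \<sim> finprod G t {1..n}" "r (Suc n) \<sim> t (Suc n)"
    using Suc.prems(1)[of "Suc n"] radicals_mult_associatedD by auto
  \<comment> \<open>The last index is settled by the second association; for smaller indices the
    first one feeds the induction hypothesis.\<close>
  then show ?case
    using Suc.IH Suc.prems by (cases "i = Suc n") auto
qed simp

end

theorem proposition6p5:
  fixes H :: "('a, 'b) monoid_scheme"
  assumes "comm_monoid_cancel H"
  shows
    "(\<forall>(n::nat) (r :: nat \<Rightarrow> 'a) (t :: nat \<Rightarrow> 'a).
        n \<ge> 1 \<longrightarrow>
        (\<forall>i\<in>{1..n}. r i \<in> radicals H \<and> t i \<in> radicals H) \<longrightarrow>
        (\<forall>i\<in>{1..<n}. r i divides\<^bsub>H\<^esub> r (i + 1) \<and> t i divides\<^bsub>H\<^esub> t (i + 1)) \<longrightarrow>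
        (\<Otimes>\<^bsub>H\<^esub>i\<in>{1..n}. r i) \<sim>\<^bsub>H\<^esub> (\<Otimes>\<^bsub>H\<^esub>i\<in>{1..n}. t i) \<longrightarrow>
        (\<forall>i\<in>{1..n}. r i \<sim>\<^bsub>H\<^esub> t i)) \<and>
     (\<forall>a\<in>carrier H. \<forall>c\<in>carrier H. \<forall>b\<in>radicals H. \<forall>d\<in>radicals H.
        (\<exists>m::nat. m \<ge> 1 \<and> a divides\<^bsub>H\<^esub> b [^]\<^bsub>H\<^esub> m) \<longrightarrow>
        (\<exists>n::nat. n \<ge> 1 \<and> c divides\<^bsub>H\<^esub> d [^]\<^bsub>H\<^esub> n) \<longrightarrow>
        (a \<otimes>\<^bsub>H\<^esub> b) \<sim>\<^bsub>H\<^esub> (c \<otimes>\<^bsub>H\<^esub> d) \<longrightarrow>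
        a \<sim>\<^bsub>H\<^esub> c \<and> b \<sim>\<^bsub>H\<^esub> d)"
proof -
  interpret comm_monoid_cancel H by (rule assms)
  show ?thesis
  proof (intro conjI allI impI ballI, goal_cases)
    case (1 n r t i)
    then show ?case
      by (intro radicals_chain_unique[of n r t i]) auto
  next
    case (2 a c b d)
    then show ?case
      using radicals_mult_associatedD(1) by blast
  next
    case (3 a c b d)
    then show ?case
      using radicals_mult_associatedD(2) by blast
  qed
qed

end
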